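(* For every integer $n\geqslant 1$, $\lfloor t_{n-1}\rfloor=v_3(n)$.
   Context: $v_3(n)$ denotes the $3$-adic valuation of the positive integer $n$, and $\lfloor x\rfloor$ the integral part of $x$. Define triples of integers $N_n=(a_n;b_n;c_n)$ for every integer $n\geqslant 1$ as the labels of the vertices of a ternary tree $\mathcal{A}_3$ read from the top and, at each level, from left to right. The top is $N_1=(1;2;0)$. For every $n\geqslant 1$, the left, middle and right children of $N_n=(a;b;c)$ are respectively $N_{3n-1}$, $N_{3n}$, $N_{3n+1}$, and they are given by: - if $b$ is odd: $N_{3n-1}=(4(c+1)a-b;\,2a;\,0)$, $N_{3n}=(a;\,2a+b;\,c+1)$, $N_{3n+1}=(2a+b;\,2a+2b;\,0)$; - if $b$ is even: $N_{3n-1}=(2(c+1)a-\frac{b}{2};\,a;\,0)$, $N_{3n}=(a;\,2a+b;\,c+1)$, $N_{3n+1}=(a+\frac{b}{2};\,a+b;\,0)$. The sequence $(t_n)_{n\geqslant 0}$ is defined by $t_0=0$ and $t_n=\frac{a_n}{b_n}$ for every $n\geqslant 1$. *)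

theory Defs
  imports Complex_Main "HOL-Computational_Algebra.Primes"
begin

fun left_child :: "int \<times> int \<times> int \<Rightarrow> int \<times> int \<times> int" where
  "left_child (a, b, c) =
     (if odd b then (4 * (c + 1) * a - b, 2 * a, 0)
      else (2 * (c + 1) * a - b div 2, a, 0))"

fun middle_child :: "int \<times> int \<times> int \<Rightarrow> int \<times> int \<times> int" where
  "middle_child (a, b, c) = (a, 2 * a + b, c + 1)"

fun right_child :: "int \<times> int \<times> int \<Rightarrow> int \<times> int \<times> int" where
  "right_child (a, b, c) =
     (if odd b then (2 * a + b, 2 * a + 2 * b, 0)
      else (a + b div 2, a + b, 0))"

(* The parent of vertex m > 1 is (m + 1) div 3; the residue of m modulo 3 tells which child
   it is (see N_children). Index 0 is not a vertex of the tree: N 0 is a dummy. *)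
function N :: "nat \<Rightarrow> int \<times> int \<times> int" where
  "N m =
     (if m \<le> 1 then (1, 2, 0)
      else if m mod 3 = 2 then left_child (N ((m + 1) div 3))
      else if m mod 3 = 0 then middle_child (N ((m + 1) div 3))
      else right_child (N ((m + 1) div 3)))"
  by pat_completeness auto
termination
  by (relation "Wellfounded.measure id") auto

declare N.simps [simp del]

lemma N_1: "N 1 = (1, 2, 0)"
  by (subst N.simps) simp

lemma N_children:
  assumes "n \<ge> 1"
  shows "N (3 * n - 1) = left_child (N n)"
    and "N (3 * n) = middle_child (N n)"
    and "N (3 * n + 1) = right_child (N n)"
proof -
  obtain k where k: "n = Suc k" using assms by (cases n) auto
  have l: "3 * n - 1 = 3 * k + 2" using k by simp
  have m: "(3 * k + 2) mod 3 = 2" "3 * n mod 3 = 0" "(3 * n + 1) mod 3 = 1"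
    by presburger+
  have d: "(3 * k + 2 + 1) div 3 = n" "(3 * n + 1) div 3 = n" "(3 * n + 1 + 1) div 3 = n"
    using k by linarith+
  have g: "(3 * k + 2 \<le> 1) = False" "(3 * n \<le> 1) = False" "(3 * n + 1 \<le> 1) = False"
    using assms by simp_all
  have z: "((2::nat) = 2) = True" "((0::nat) = 2) = False" "((0::nat) = 0) = True"
    "((1::nat) = 2) = False" "((1::nat) = 0) = False"
    by simp_all
  show "N (3 * n - 1) = left_child (N n)"
    unfolding l by (subst N.simps) (simp only: m d g z if_True if_False)
  show "N (3 * n) = middle_child (N n)"
    by (subst N.simps) (simp only: m d g z if_True if_False)
  show "N (3 * n + 1) = right_child (N n)"
    by (subst N.simps) (simp only: m d g z if_True if_False)
qed

definition a_seq :: "nat \<Rightarrow> int" where "a_seq n = fst (N n)"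
definition b_seq :: "nat \<Rightarrow> int" where "b_seq n = fst (snd (N n))"

definition t :: "nat \<Rightarrow> real" where
  "t n = (if n = 0 then 0 else of_int (a_seq n) / of_int (b_seq n))"

end

theory Submission
  imports Defs
begin

text \<open>
  On the ratios the recursion forgets the parity of \<open>b\<close>: if a vertex has ratio \<open>t\<close> and third
  label \<open>c\<close>, its children have the ratios
  \<open>2(c + 1) - 1/(2t)\<close>, \<open>t/(2t + 1)\<close> and \<open>(2t + 1)/(2(t + 1))\<close>.
  The last two lie in \<open>[0, 1)\<close>, as they must, because the middle and right children of
  vertex \<open>k\<close> have the indices \<open>n - 1 = 3k\<close> and \<open>n - 1 = 3k + 1\<close>, so that \<open>3\<close> does not divide \<open>n\<close>.
  The left child has index \<open>n - 1 = 3k - 1\<close>, so \<open>n = 3k\<close> has valuation \<open>v\<^sub>3(k) + 1\<close>.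

  What makes the left case work is that the labels of vertex \<open>k\<close> themselves know \<open>v\<^sub>3(k)\<close>, in two
  ways: \<open>c = v\<^sub>3(k)\<close>, as \<open>c\<close> counts the middle steps that end the path to \<open>k\<close>, and
  \<open>c < 1/(2t) \<le> c + 1\<close>, since a middle step adds exactly \<open>1\<close> to \<open>1/(2t)\<close> while every other
  vertex has \<open>t \<ge> 1/2\<close>.  Hence \<open>2(c + 1) - 1/(2t)\<close> lies in \<open>[c + 1, c + 2)\<close>.
  The lemma \<open>label_bounds\<close> proves this invariant by induction along the tree.
\<close>

lemma vertex_cases:
  fixes n :: nat
  assumes "n \<ge> 1"
  obtains (top) "n = 1"
    | (left) k where "k \<ge> 1" "k < n" "n = 3 * k - 1"
    | (middle) k where "k \<ge> 1" "k < n" "n = 3 * k"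
    | (right) k where "k \<ge> 1" "k < n" "n = 3 * k + 1"
proof -
  define k where "k = (n + 1) div 3"
  have "n = 1 \<or> k \<ge> 1 \<and> k < n \<and> (n = 3 * k - 1 \<or> n = 3 * k \<or> n = 3 * k + 1)"
    using assms unfolding k_def by presburger
  then show thesis using that by blast
qed

lemma multiplicity_3_of_children:
  assumes "k \<ge> 1"
  shows "multiplicity 3 (3 * k) = Suc (multiplicity 3 (k::nat))"
    and "multiplicity 3 (3 * k - 1) = 0"
    and "multiplicity 3 (3 * k + 1) = 0"
    and "multiplicity 3 (3 * k + 2) = 0"
proof -
  show "multiplicity 3 (3 * k) = Suc (multiplicity 3 k)"
    using assms by (intro multiplicity_times_same) auto
  have "\<not> 3 dvd 3 * k - 1" "\<not> 3 dvd 3 * k + 1" "\<not> 3 dvd 3 * k + 2"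
    using assms by presburger+
  then show "multiplicity 3 (3 * k - 1) = 0" "multiplicity 3 (3 * k + 1) = 0"
    "multiplicity 3 (3 * k + 2) = 0"
    by (auto intro: not_dvd_imp_multiplicity_0)
qed

text \<open>
  The bounds on \<open>b\<close> are \<open>c < 1/(2t) \<le> c + 1\<close> for \<open>t = a/b\<close>, cleared of denominators.
  At the top and at a left or right child, where \<open>c = 0\<close>, they reduce to \<open>t \<ge> 1/2\<close>; at a middle child they are
  the bounds of the parent shifted by \<open>2a\<close>.
\<close>

lemma label_bounds:
  assumes "n \<ge> 1" and "N n = (a, b, c)"
  shows "a > 0" "c = int (multiplicity 3 n)" "2 * a * c < b" "b \<le> 2 * a * (c + 1)"
proof -
  have "a > 0 \<and> c = int (multiplicity 3 n) \<and> 2 * a * c < b \<and> b \<le> 2 * a * (c + 1)"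
    using assms
  proof (induction n arbitrary: a b c rule: less_induct)
    case (less n)
    \<comment> \<open>The product \<open>a'c'\<close> is isolated because the step is linear in it, given only its sign.\<close>
    have parent: "a' > 0 \<and> c' = int (multiplicity 3 k) \<and> a' * c' \<ge> 0 \<and> b' > 0 \<and>
        2 * (a' * c') < b' \<and> b' \<le> 2 * (a' * c') + 2 * a'"
      if "k \<ge> 1" "k < n" "N k = (a', b', c')" for k a' b' c'
    proof -
      have IH: "a' > 0" "c' = int (multiplicity 3 k)" "2 * a' * c' < b'" "b' \<le> 2 * a' * (c' + 1)"
        using less.IH[OF that(2,1,3)] by auto
      moreover have "a' * c' \<ge> 0" using IH(1,2) by simp
      ultimately show ?thesis
        unfolding distrib_left mult.assoc mult_1_right by (intro conjI) linarith+
    qed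
    from less.prems(1) show ?case
    proof (cases rule: vertex_cases)
      case top
      then show ?thesis using less.prems(2) N_1 by auto
    next
      case (left k)
      obtain a' b' c' where N: "N k = (a', b', c')" by (cases "N k")
      define p where "p = a' * c'"
      have p: "a' > 0" "p \<ge> 0" "b' \<le> 2 * p + 2 * a'"
        using parent[OF left(1,2) N] by (auto simp: p_def)
      have "(a, b, c) = left_child (a', b', c')"
        using less.prems(2) left N_children(1)[OF left(1)] N by simp
      then have "(a, b, c) = (if odd b' then (4 * p + 4 * a' - b', 2 * a', 0)
          else (2 * p + 2 * a' - b' div 2, a', 0))"
        by (simp add: p_def algebra_simps)
      then have "a > 0 \<and> c = 0 \<and> 0 < b \<and> b \<le> 2 * a"
        using p by (auto split: if_splits)
      then show ?thesis
        using left(3) multiplicity_3_of_children(2)[OF left(1)] by simp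
    next
      case (middle k)
      obtain a' b' c' where N: "N k = (a', b', c')" by (cases "N k")
      show ?thesis
        using less.prems(2) parent[OF middle(1,2) N] middle N_children(2)[OF middle(1)]
          multiplicity_3_of_children(1)[OF middle(1)] N
        by (auto simp: algebra_simps)
    next
      case (right k)
      obtain a' b' c' where N: "N k = (a', b', c')" by (cases "N k")
      have p: "a' > 0" "b' > 0"
        using parent[OF right(1,2) N] by auto
      have "(a, b, c) = right_child (a', b', c')"
        using less.prems(2) right N_children(3)[OF right(1)] N by simp
      then have "a > 0 \<and> c = 0 \<and> 0 < b \<and> b \<le> 2 * a"
        using p by (auto split: if_splits)
      then show ?thesis
        using right(3) multiplicity_3_of_children(3)[OF right(1)] by simp
    qed
  qed
  then show "a > 0" "c = int (multiplicity 3 n)" "2 * a * c < b" "b \<le> 2 * a * (c + 1)"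
    by auto
qed

lemma floor_t_eq:
  assumes "n \<ge> 1" "N n = (a, b, c)" "b > 0" "q * b \<le> a" "a < (q + 1) * b"
  shows "\<lfloor>t n\<rfloor> = q"
proof -
  have "a div b = q"
    using assms(3-5) by (intro int_div_pos_eq[of a b q "a - q * b"]) (auto simp: algebra_simps)
  then show ?thesis
    using assms(1,2) by (simp add: t_def a_seq_def b_seq_def floor_divide_of_int_eq)
qed

theorem proposition2:
  fixes n :: nat
  assumes "n \<ge> 1"
  shows "\<lfloor>t (n - 1)\<rfloor> = int (multiplicity 3 n)"
proof (cases "n = 1")
  case True
  then show ?thesis by (simp add: t_def)
next
  case False
  define m where "m = n - 1"
  have m: "m \<ge> 1" "n = m + 1" using assms False by (auto simp: m_def)
  have "\<lfloor>t m\<rfloor> = int (multiplicity 3 (m + 1))"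
    using m(1)
  proof (cases rule: vertex_cases)
    case top
    have "multiplicity 3 (2::nat) = 0" by (rule not_dvd_imp_multiplicity_0) simp
    then show ?thesis using floor_t_eq[of 1 1 2 0 0] top N_1 by (simp add: numeral_2_eq_2)
  next
    case (left k)
    obtain a b c where N: "N k = (a, b, c)" by (cases "N k")
    note bounds = label_bounds[OF left(1) N]
    have Nm: "N m = left_child (a, b, c)" using left N_children(1)[of k] N by simp
    have "\<lfloor>t m\<rfloor> = c + 1"
    proof (cases "odd b")
      case True
      show ?thesis
        by (rule floor_t_eq[of m "4 * (c + 1) * a - b" "2 * a" 0])
          (use m(1) Nm True bounds in \<open>auto simp: algebra_simps\<close>)
    next
      case False
      show ?thesis
        by (rule floor_t_eq[of m "2 * (c + 1) * a - b div 2" a 0])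
          (use m(1) Nm False bounds in \<open>auto simp: algebra_simps\<close>)
    qed
    moreover have "m + 1 = 3 * k" using left by simp
    ultimately show ?thesis
      using bounds(2) multiplicity_3_of_children(1)[OF left(1)] by simp
  next
    case (middle k)
    obtain a b c where N: "N k = (a, b, c)" by (cases "N k")
    note bounds = label_bounds[OF middle(1) N]
    have "b > 0" using bounds by (smt (verit) mult_nonneg_nonneg of_nat_0_le_iff)
    then have "\<lfloor>t m\<rfloor> = 0"
      using floor_t_eq[of m a "2 * a + b" "c + 1" 0] m(1) middle N_children(2)[of k] N bounds(1)
      by simp
    then show ?thesis
      using middle multiplicity_3_of_children(3)[OF middle(1)] by simp
  next
    case (right k)
    obtain a b c where N: "N k = (a, b, c)" by (cases "N k")
    note bounds = label_bounds[OF right(1) N]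
    have b: "b > 0" using bounds by (smt (verit) mult_nonneg_nonneg of_nat_0_le_iff)
    have Nm: "N m = right_child (a, b, c)" using right N_children(3)[of k] N by simp
    have "\<lfloor>t m\<rfloor> = 0"
    proof (cases "odd b")
      case True
      show ?thesis
        by (rule floor_t_eq[of m "2 * a + b" "2 * a + 2 * b" 0]) (use m(1) Nm True b bounds(1) in auto)
    next
      case False
      show ?thesis
        by (rule floor_t_eq[of m "a + b div 2" "a + b" 0]) (use m(1) Nm False b bounds(1) in auto)
    qed
    then show ?thesis
      using right multiplicity_3_of_children(4)[OF right(1)] by simp
  qed
  then show ?thesis using m(2) by simp
qed

end
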